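(* Let $A$ be a flexible symmetric 0-dialgebra. On $A\oplus A$ define $(a,b)\dashv(c,d)=(a\dashv c-d\vdash b^\ast,\; a^\ast\dashv d+c\vdash b)$, $(a,b)\vdash(c,d)=(a\vdash c-d\dashv b^\ast,\; a^\ast\vdash d+c\dashv b)$ and $(a,b)^\ast=(a^\ast,-b)$. Then $A\oplus A$ with these operations is also a flexible symmetric 0-dialgebra. In particular, this holds if $A$ is an alternative symmetric 0-dialgebra.
   Context: A 0-dialgebra with involution is a vector space with bilinear operations $\dashv,\vdash$ satisfying $a\dashv(b\dashv c)=a\dashv(b\vdash c)$ and $(a\dashv b)\vdash c=(a\vdash b)\vdash c$, together with a linear map $\ast$ with $(a^\ast)^\ast=a$, $(a\dashv b)^\ast=b^\ast\vdash a^\ast$, $(a\vdash b)^\ast=b^\ast\dashv a^\ast$. Write $\mathrm{sym}(x)=x+x^\ast$ and $\{x,y\}=x\dashv y-y\vdash x$; it is partially symmetric if $\{\mathrm{sym}(x),y\}=0$ and $\{x,\mathrm{sym}(y)\}=0$ for all $x,y$. Associators: $(a,b,c)_\dashv=(a\dashv b)\dashv c-a\dashv(b\dashv c)$, $(a,b,c)_\times=(a\vdash b)\dashv c-a\vdash(b\dashv c)$, $(a,b,c)_\vdash=(a\vdash b)\vdash c-a\vdash(b\vdash c)$. A partially symmetric 0-dialgebra is symmetric if for each $\circ\in\{\dashv,\times,\vdash\}$ and all $x,y,z$: $(x,y,z)_\circ+(x^\ast,y,z)_\circ=0$, $(x,y,z)_\circ+(x,y^\ast,z)_\circ=0$, $(x,y,z)_\circ+(x,y,z^\ast)_\circ=0$.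 It is flexible if $(a,b,c)_\dashv+(c,b,a)_\vdash=0$ and $(a,b,c)_\times+(c,b,a)_\times=0$ for all $a,b,c$, and alternative if $(a,b,c)_\dashv+(c,b,a)_\vdash=0$, $(a,b,c)_\dashv-(b,c,a)_\vdash=0$ and $(a,b,c)_\times+(a,c,b)_\vdash=0$ for all $a,b,c$. *)

theory Defs
  imports Complex_Main "HOL-Library.Product_Plus"
begin

text \<open>A 0-dialgebra with involution over a field 'k: underlying vector space given by the
scalar multiplication sc on the additive group 'v; ld is the left product (dashv),
rd the right product (vdash), st the involution.\<close>

definition bilinear_op :: "('k::field \<Rightarrow> 'v::ab_group_add \<Rightarrow> 'v) \<Rightarrow> ('v \<Rightarrow> 'v \<Rightarrow> 'v) \<Rightarrow> bool" where
  "bilinear_op sc m \<longleftrightarrow> (\<forall>x. Vector_Spaces.linear sc sc (\<lambda>y. m x y)) \<and>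
                         (\<forall>y. Vector_Spaces.linear sc sc (\<lambda>x. m x y))"

definition zero_dialg_inv ::
  "('k::field \<Rightarrow> 'v::ab_group_add \<Rightarrow> 'v) \<Rightarrow> ('v \<Rightarrow> 'v \<Rightarrow> 'v) \<Rightarrow> ('v \<Rightarrow> 'v \<Rightarrow> 'v) \<Rightarrow> ('v \<Rightarrow> 'v) \<Rightarrow> bool" where
  "zero_dialg_inv sc ld rd st \<longleftrightarrow>
     vector_space sc \<and> bilinear_op sc ld \<and> bilinear_op sc rd \<and> Vector_Spaces.linear sc sc st \<and>
     (\<forall>a b c. ld a (ld b c) = ld a (rd b c)) \<and>
     (\<forall>a b c. rd (ld a b) c = rd (rd a b) c) \<and>
     (\<forall>a. st (st a) = a) \<and>
     (\<forall>a b. st (ld a b) = rd (st b) (st a)) \<and>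
     (\<forall>a b. st (rd a b) = ld (st b) (st a))"

definition sym_el :: "('v::ab_group_add \<Rightarrow> 'v) \<Rightarrow> 'v \<Rightarrow> 'v" where
  "sym_el st x = x + st x"

definition dibr :: "('v::ab_group_add \<Rightarrow> 'v \<Rightarrow> 'v) \<Rightarrow> ('v \<Rightarrow> 'v \<Rightarrow> 'v) \<Rightarrow> 'v \<Rightarrow> 'v \<Rightarrow> 'v" where
  "dibr ld rd x y = ld x y - rd y x"

definition partially_symmetric ::
  "('k::field \<Rightarrow> 'v::ab_group_add \<Rightarrow> 'v) \<Rightarrow> ('v \<Rightarrow> 'v \<Rightarrow> 'v) \<Rightarrow> ('v \<Rightarrow> 'v \<Rightarrow> 'v) \<Rightarrow> ('v \<Rightarrow> 'v) \<Rightarrow> bool" where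
  "partially_symmetric sc ld rd st \<longleftrightarrow> zero_dialg_inv sc ld rd st \<and>
     (\<forall>x y. dibr ld rd (sym_el st x) y = 0) \<and> (\<forall>x y. dibr ld rd x (sym_el st y) = 0)"

definition assoc_l :: "('v::ab_group_add \<Rightarrow> 'v \<Rightarrow> 'v) \<Rightarrow> ('v \<Rightarrow> 'v \<Rightarrow> 'v) \<Rightarrow> 'v \<Rightarrow> 'v \<Rightarrow> 'v \<Rightarrow> 'v" where
  "assoc_l ld rd a b c = ld (ld a b) c - ld a (ld b c)"
definition assoc_x :: "('v::ab_group_add \<Rightarrow> 'v \<Rightarrow> 'v) \<Rightarrow> ('v \<Rightarrow> 'v \<Rightarrow> 'v) \<Rightarrow> 'v \<Rightarrow> 'v \<Rightarrow> 'v \<Rightarrow> 'v" where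
  "assoc_x ld rd a b c = ld (rd a b) c - rd a (ld b c)"
definition assoc_r :: "('v::ab_group_add \<Rightarrow> 'v \<Rightarrow> 'v) \<Rightarrow> ('v \<Rightarrow> 'v \<Rightarrow> 'v) \<Rightarrow> 'v \<Rightarrow> 'v \<Rightarrow> 'v \<Rightarrow> 'v" where
  "assoc_r ld rd a b c = rd (rd a b) c - rd a (rd b c)"

definition symmetric_dialg ::
  "('k::field \<Rightarrow> 'v::ab_group_add \<Rightarrow> 'v) \<Rightarrow> ('v \<Rightarrow> 'v \<Rightarrow> 'v) \<Rightarrow> ('v \<Rightarrow> 'v \<Rightarrow> 'v) \<Rightarrow> ('v \<Rightarrow> 'v) \<Rightarrow> bool" where
  "symmetric_dialg sc ld rd st \<longleftrightarrow> partially_symmetric sc ld rd st \<and>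
     (\<forall>as \<in> {assoc_l ld rd, assoc_x ld rd, assoc_r ld rd}. \<forall>x y z.
        as x y z + as (st x) y z = 0 \<and> as x y z + as x (st y) z = 0 \<and> as x y z + as x y (st z) = 0)"

definition flexible_dialg ::
  "('k::field \<Rightarrow> 'v::ab_group_add \<Rightarrow> 'v) \<Rightarrow> ('v \<Rightarrow> 'v \<Rightarrow> 'v) \<Rightarrow> ('v \<Rightarrow> 'v \<Rightarrow> 'v) \<Rightarrow> ('v \<Rightarrow> 'v) \<Rightarrow> bool" where
  "flexible_dialg sc ld rd st \<longleftrightarrow> zero_dialg_inv sc ld rd st \<and>
     (\<forall>a b c. assoc_l ld rd a b c + assoc_r ld rd c b a = 0) \<and>
     (\<forall>a b c. assoc_x ld rd a b c + assoc_x ld rd c b a = 0)"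

definition alternative_dialg ::
  "('k::field \<Rightarrow> 'v::ab_group_add \<Rightarrow> 'v) \<Rightarrow> ('v \<Rightarrow> 'v \<Rightarrow> 'v) \<Rightarrow> ('v \<Rightarrow> 'v \<Rightarrow> 'v) \<Rightarrow> ('v \<Rightarrow> 'v) \<Rightarrow> bool" where
  "alternative_dialg sc ld rd st \<longleftrightarrow> zero_dialg_inv sc ld rd st \<and>
     (\<forall>a b c. assoc_l ld rd a b c + assoc_r ld rd c b a = 0) \<and>
     (\<forall>a b c. assoc_l ld rd a b c - assoc_r ld rd b c a = 0) \<and>
     (\<forall>a b c. assoc_x ld rd a b c + assoc_r ld rd a c b = 0)"

definition dbl_sc :: "('k \<Rightarrow> 'v \<Rightarrow> 'v) \<Rightarrow> 'k \<Rightarrow> 'v \<times> 'v \<Rightarrow> 'v \<times> 'v" where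
  "dbl_sc sc k p = (sc k (fst p), sc k (snd p))"

definition dbl_ld :: "('v::ab_group_add \<Rightarrow> 'v \<Rightarrow> 'v) \<Rightarrow> ('v \<Rightarrow> 'v \<Rightarrow> 'v) \<Rightarrow> ('v \<Rightarrow> 'v)
    \<Rightarrow> 'v \<times> 'v \<Rightarrow> 'v \<times> 'v \<Rightarrow> 'v \<times> 'v" where
  "dbl_ld ld rd st p q = (case p of (a, b) \<Rightarrow> case q of (c, d) \<Rightarrow>
       (ld a c - rd d (st b), ld (st a) d + rd c b))"

definition dbl_rd :: "('v::ab_group_add \<Rightarrow> 'v \<Rightarrow> 'v) \<Rightarrow> ('v \<Rightarrow> 'v \<Rightarrow> 'v) \<Rightarrow> ('v \<Rightarrow> 'v)
    \<Rightarrow> 'v \<times> 'v \<Rightarrow> 'v \<times> 'v \<Rightarrow> 'v \<times> 'v" where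
  "dbl_rd ld rd st p q = (case p of (a, b) \<Rightarrow> case q of (c, d) \<Rightarrow>
       (rd a c - ld d (st b), rd (st a) d + ld c b))"

definition dbl_st :: "('v::ab_group_add \<Rightarrow> 'v) \<Rightarrow> 'v \<times> 'v \<Rightarrow> 'v \<times> 'v" where
  "dbl_st st p = (case p of (a, b) \<Rightarrow> (st a, - b))"

end

theory Submission
  imports Defs
begin

text \<open>Call \<open>u\<close> skew if \<open>u\<^sup>* = -u\<close>. In a symmetric dialgebra the star maps \<open>(a,b,c)\<close> of
  type \<open>\<stileturn>\<close> to \<open>(c,b,a)\<close> of type \<open>\<turnstile>\<close>, so flexibility says exactly that all associators are
  skew; moreover all brackets \<open>{x,y}\<close> are skew. In the double, \<open>sym(a,b) = (sym(a),0)\<close>, so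
  a double associator is skew iff its first component is, and that component is a sum of
  associators and brackets of \<open>A\<close>. Likewise symmetry only requires the double associators
  with an entry \<open>(sym(a),0)\<close> to vanish.\<close>

locale involutive_dialgebra =
  fixes sc :: "'k::field \<Rightarrow> 'v::ab_group_add \<Rightarrow> 'v"
    and ld :: "'v \<Rightarrow> 'v \<Rightarrow> 'v" (infixl "\<stileturn>" 70)
    and rd :: "'v \<Rightarrow> 'v \<Rightarrow> 'v" (infixl "\<turnstile>" 70)
    and st :: "'v \<Rightarrow> 'v"
  assumes zero_dialg: "zero_dialg_inv sc ld rd st"
begin

abbreviation "symm \<equiv> sym_el st"
abbreviation "AL \<equiv> assoc_l ld rd"
abbreviation "AX \<equiv> assoc_x ld rd"
abbreviation "AR \<equiv> assoc_r ld rd"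
abbreviation "br \<equiv> dibr ld rd"

lemma linear_ld_left: "Vector_Spaces.linear sc sc (\<lambda>x. x \<stileturn> y)"
  and linear_ld_right: "Vector_Spaces.linear sc sc (\<lambda>y. x \<stileturn> y)"
  and linear_rd_left: "Vector_Spaces.linear sc sc (\<lambda>x. x \<turnstile> y)"
  and linear_rd_right: "Vector_Spaces.linear sc sc (\<lambda>y. x \<turnstile> y)"
  and linear_st: "Vector_Spaces.linear sc sc st"
  and vector_space_sc: "vector_space sc"
  using zero_dialg unfolding zero_dialg_inv_def bilinear_op_def by blast+

lemma ld_bar: "a \<stileturn> (b \<turnstile> c) = a \<stileturn> (b \<stileturn> c)"
  and rd_bar: "(a \<stileturn> b) \<turnstile> c = (a \<turnstile> b) \<turnstile> c"
  and st_st [simp]: "st (st a) = a"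
  and st_ld: "st (a \<stileturn> b) = st b \<turnstile> st a"
  and st_rd: "st (a \<turnstile> b) = st b \<stileturn> st a"
  using zero_dialg unfolding zero_dialg_inv_def by auto

lemmas linear_rules = linear_ld_left linear_ld_right linear_rd_left linear_rd_right linear_st

lemmas lin_add = linear_rules[THEN Vector_Spaces.linear.axioms(3), THEN module_hom.add]
lemmas lin_scale = linear_rules[THEN Vector_Spaces.linear.axioms(3), THEN module_hom.scale]
lemmas lin_diff = linear_rules[THEN Vector_Spaces.linear.axioms(3), THEN module_hom.diff]
lemmas lin_neg = linear_rules[THEN Vector_Spaces.linear.axioms(3), THEN module_hom.neg]
lemmas lin_zero [simp] = linear_rules[THEN Vector_Spaces.linear.axioms(3), THEN module_hom.zero]

lemma st_sym [simp]: "st (symm x) = symm x"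
  by (simp add: sym_el_def lin_add add.commute)

lemma sym_st [simp]: "symm (st x) = symm x"
  by (simp add: sym_el_def add.commute)

lemma sym_add: "symm (x + y) = symm x + symm y"
  and sym_diff: "symm (x - y) = symm x - symm y"
  by (simp_all add: sym_el_def lin_add lin_diff algebra_simps)

lemma assoc_zero [simp]:
  "AL 0 y z = 0" "AL x 0 z = 0" "AL x y 0 = 0"
  "AX 0 y z = 0" "AX x 0 z = 0" "AX x y 0 = 0"
  "AR 0 y z = 0" "AR x 0 z = 0" "AR x y 0 = 0"
  by (simp_all add: assoc_l_def assoc_x_def assoc_r_def)

lemma br_zero [simp]: "br 0 y = 0" "br x 0 = 0"
  by (simp_all add: dibr_def)

lemma assoc_sym:
  "AL (symm x) y z = AL x y z + AL (st x) y z"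
  "AL x (symm y) z = AL x y z + AL x (st y) z"
  "AL x y (symm z) = AL x y z + AL x y (st z)"
  "AX (symm x) y z = AX x y z + AX (st x) y z"
  "AX x (symm y) z = AX x y z + AX x (st y) z"
  "AX x y (symm z) = AX x y z + AX x y (st z)"
  "AR (symm x) y z = AR x y z + AR (st x) y z"
  "AR x (symm y) z = AR x y z + AR x (st y) z"
  "AR x y (symm z) = AR x y z + AR x y (st z)"
  by (simp_all add: assoc_l_def assoc_x_def assoc_r_def sym_el_def lin_add algebra_simps)

lemma st_assoc:
  "st (AL a b c) = - AR (st c) (st b) (st a)"
  "st (AX a b c) = - AX (st c) (st b) (st a)"
  "st (AR a b c) = - AL (st c) (st b) (st a)"
  by (simp_all add: assoc_l_def assoc_x_def assoc_r_def lin_diff st_ld st_rd)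

lemma AR_conv_AL: "AR a b c = - st (AL (st c) (st b) (st a))"
  by (simp add: st_assoc)

text \<open>Additivity turns a condition such as \<open>AL x y z + AL (st x) y z = 0\<close> into
  the vanishing of an associator with a \<open>symm\<close> entry. The star fixes
  \<open>symm\<close> elements and exchanges \<open>AL\<close> with \<open>AR\<close> up to sign,
  which carries the vanishing over to \<open>AR\<close>.\<close>

lemma symmetric_dialg_iff:
  "symmetric_dialg sc ld rd st \<longleftrightarrow>
     (\<forall>x y. br (symm x) y = 0) \<and> (\<forall>x y. br x (symm y) = 0) \<and>
     (\<forall>x y z. AL (symm x) y z = 0 \<and> AL x (symm y) z = 0 \<and> AL x y (symm z) = 0) \<and>
     (\<forall>x y z. AX (symm x) y z = 0 \<and> AX x (symm y) z = 0 \<and> AX x y (symm z) = 0)"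
proof -
  have "AR (symm x) y z = 0 \<and> AR x (symm y) z = 0 \<and> AR x y (symm z) = 0"
    if "\<And>x y z. AL (symm x) y z = 0 \<and> AL x (symm y) z = 0 \<and> AL x y (symm z) = 0" for x y z
    using that by (simp add: AR_conv_AL)
  then show ?thesis
    unfolding symmetric_dialg_def partially_symmetric_def
    by (auto simp: zero_dialg assoc_sym)
qed

end

locale symmetric_dialgebra = involutive_dialgebra +
  assumes symmetric: "symmetric_dialg sc ld rd st"
begin

lemma sym_ld: "symm x \<stileturn> y = y \<turnstile> symm x"
  and ld_sym: "y \<stileturn> symm x = symm x \<turnstile> y"
  using symmetric by (simp_all add: symmetric_dialg_iff dibr_def)

lemma br_sym [simp]: "br (symm x) y = 0" "br x (symm y) = 0"
  by (simp_all add: dibr_def sym_ld ld_sym)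

lemma assoc_sym_zero [simp]:
  "AL (symm x) y z = 0" "AL x (symm y) z = 0" "AL x y (symm z) = 0"
  "AX (symm x) y z = 0" "AX x (symm y) z = 0" "AX x y (symm z) = 0"
  "AR (symm x) y z = 0" "AR x (symm y) z = 0" "AR x y (symm z) = 0"
  using symmetric by (simp_all add: symmetric_dialg_iff AR_conv_AL)

lemma assoc_st [simp]:
  "AL (st x) y z = - AL x y z" "AL x (st y) z = - AL x y z" "AL x y (st z) = - AL x y z"
  "AX (st x) y z = - AX x y z" "AX x (st y) z = - AX x y z" "AX x y (st z) = - AX x y z"
  "AR (st x) y z = - AR x y z" "AR x (st y) z = - AR x y z" "AR x y (st z) = - AR x y z"
  using assoc_sym[of x y z, symmetric] by (simp_all add: eq_neg_iff_add_eq_0 add.commute)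

lemma sym_ld_assoc: "symm x \<stileturn> y \<stileturn> z = symm x \<stileturn> (y \<stileturn> z)"
  and ld_sym_assoc: "x \<stileturn> symm y \<stileturn> z = x \<stileturn> (symm y \<stileturn> z)"
  and rd_sym_ld: "x \<turnstile> symm y \<stileturn> z = x \<turnstile> (symm y \<stileturn> z)"
  and sym_rd_ld: "symm x \<turnstile> y \<stileturn> z = symm x \<turnstile> (y \<stileturn> z)"
  and sym_rd_assoc: "symm x \<turnstile> y \<turnstile> z = symm x \<turnstile> (y \<turnstile> z)"
  and rd_sym_assoc: "x \<turnstile> symm y \<turnstile> z = x \<turnstile> (symm y \<turnstile> z)"
  using assoc_sym_zero unfolding assoc_l_def assoc_x_def assoc_r_def by simp_all

text \<open>The three signs from \<open>assoc_st\<close> cancel the minus sign in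
  \<open>st_assoc\<close>, so \<open>st (AL a b c) = AR c b a\<close> and
  \<open>st (AX a b c) = AX c b a\<close>.\<close>

lemma flexible_dialg_iff:
  "flexible_dialg sc ld rd st \<longleftrightarrow>
     (\<forall>a b c. symm (AL a b c) = 0) \<and> (\<forall>a b c. symm (AX a b c) = 0)"
  unfolding flexible_dialg_def by (simp add: zero_dialg sym_el_def st_assoc)

text \<open>Expanding the two vanishing brackets gives
  \<open>br (st x) (st y) = - br x (st y) = br x y\<close>, while the star sends
  \<open>br x y\<close> to \<open>- br (st x) (st y)\<close>.\<close>

lemma sym_br [simp]: "symm (br x y) = 0"
proof -
  have "br (symm x) (st y) = br x (st y) + br (st x) (st y)"
    and "br x (symm y) = br x y + br x (st y)"
    by (simp_all add: dibr_def sym_el_def lin_add)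
  then have "br (st x) (st y) = br x y"
    by (simp add: add_eq_0_iff)
  moreover have "st (br x y) = - br (st x) (st y)"
    by (simp add: dibr_def lin_diff st_ld st_rd)
  ultimately show ?thesis by (simp add: sym_el_def)
qed

end

text \<open>Comparing \<open>l\<close> with \<open>lr\<close> shows that \<open>assoc_r\<close>
  changes sign when its first two arguments are swapped. By \<open>x\<close>, the two terms of the
  flexible law for \<open>assoc_x\<close> are \<open>- assoc_r ld rd a c b\<close> and
  \<open>- assoc_r ld rd c a b\<close>, which therefore cancel.\<close>

lemma alternative_imp_flexible:
  assumes "alternative_dialg sc ld rd st"
  shows "flexible_dialg sc ld rd st"
proof -
  have l: "assoc_l ld rd a b c + assoc_r ld rd c b a = 0"
    and lr: "assoc_l ld rd a b c - assoc_r ld rd b c a = 0"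
    and x: "assoc_x ld rd a b c + assoc_r ld rd a c b = 0" for a b c
    using assms unfolding alternative_dialg_def by auto
  have "assoc_r ld rd b c a + assoc_r ld rd c b a = 0" for a b c
    using l[of a b c] lr[of a b c] by simp
  then have "assoc_x ld rd a b c + assoc_x ld rd c b a = 0" for a b c
    using x[of a b c] x[of c b a] by (metis add.inverse_inverse add_eq_0_iff minus_add_cancel)
  with l show ?thesis
    using assms unfolding alternative_dialg_def flexible_dialg_def by auto
qed

context involutive_dialgebra
begin

abbreviation "DL \<equiv> dbl_ld ld rd st"
abbreviation "DR \<equiv> dbl_rd ld rd st"

text \<open>The doubled products are arranged so that each bar identity splits, summand by summand,
  into bar identities of the original algebra.\<close>

lemma zero_dialg_dbl: "zero_dialg_inv (dbl_sc sc) DL DR (dbl_st st)"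
proof -
  interpret vector_space sc by (rule vector_space_sc)
  have vs: "vector_space (dbl_sc sc)"
    by unfold_locales (auto simp: dbl_sc_def scale_right_distrib scale_left_distrib)
  have lin: "Vector_Spaces.linear (dbl_sc sc) (dbl_sc sc) f"
    if "\<And>p q. f (p + q) = f p + f q" "\<And>k p. f (dbl_sc sc k p) = dbl_sc sc k (f p)" for f
    using vs that by (simp add: Vector_Spaces.linear_iff)
  show ?thesis
    unfolding zero_dialg_inv_def bilinear_op_def
    by (auto intro!: vs lin simp: dbl_ld_def dbl_rd_def dbl_st_def dbl_sc_def
        lin_add lin_scale lin_diff lin_neg ld_bar rd_bar st_ld st_rd
        scale_right_diff_distrib scale_right_distrib algebra_simps split: prod.splits)
qed

lemma sym_dbl: "sym_el (dbl_st st) (a, b) = (symm a, 0)"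
  by (simp add: sym_el_def dbl_st_def)

end

context symmetric_dialgebra
begin

text \<open>Each product in the first component contains an even number of \<open>b\<close>,
  \<open>d\<close>, \<open>f\<close>, which leaves the groups \<open>a c e\<close>,
  \<open>b d e\<close>, \<open>a d f\<close> and \<open>b c f\<close>. In the last three the two
  products differ by a cyclic rotation of the letters: a bracket moves one factor past the product
  of the other two, and associators absorb the rebracketing.\<close>

lemma fst_assoc_l_dbl:
  "fst (assoc_l DL DR (a, b) (c, d) (e, f)) =
     AL a c e + AR e d (st b) - br (d \<turnstile> st b) e + br a (f \<turnstile> st d) + AR f (st d) a
     + AR (st c) f (st b) + AX f (st b) (st c) - br (f \<turnstile> st b) (st c)"
  unfolding assoc_l_def[of DL] assoc_l_def[of ld] assoc_x_def assoc_r_def dibr_def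
  by (simp add: dbl_ld_def lin_add lin_diff st_ld st_rd rd_bar algebra_simps)

lemma fst_assoc_x_dbl:
  "fst (assoc_x DL DR (a, b) (c, d) (e, f)) =
     AX a c e + AX e d (st b) - br (d \<stileturn> st b) e - br (f \<turnstile> st d) a + AX f (st d) a
     + AL (st c) f (st b) + AR f (st b) (st c) + br (st c) (f \<turnstile> st b)"
  unfolding assoc_x_def[of DL] assoc_l_def assoc_x_def[of ld] assoc_r_def dibr_def
  by (simp add: dbl_ld_def dbl_rd_def lin_add lin_diff st_ld st_rd ld_bar algebra_simps)

text \<open>The groups now contain an odd number of \<open>b\<close>, \<open>d\<close>,
  \<open>f\<close>. They are kept as differences, whose two sides become equal once one factor is
  symmetric.\<close>

lemma snd_assoc_l_dbl:
  "snd (assoc_l DL DR (a, b) (c, d) (e, f)) =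
     ((st c \<turnstile> st a) \<stileturn> f - st a \<stileturn> (st c \<stileturn> f)) + ((f \<turnstile> st d) \<turnstile> b - (b \<stileturn> st d) \<stileturn> f)
     + (e \<turnstile> (st a \<stileturn> d) - st a \<stileturn> (e \<stileturn> d)) + (e \<turnstile> (c \<turnstile> b) - (c \<turnstile> e) \<turnstile> b)"
  by (simp add: assoc_l_def dbl_ld_def lin_add lin_diff st_ld st_rd ld_bar rd_bar algebra_simps)

lemma snd_assoc_x_dbl:
  "snd (assoc_x DL DR (a, b) (c, d) (e, f)) =
     ((st c \<stileturn> st a) \<stileturn> f - st a \<turnstile> (st c \<stileturn> f)) + ((f \<turnstile> st d) \<stileturn> b - (b \<turnstile> st d) \<stileturn> f)
     + (e \<turnstile> (st a \<turnstile> d) - st a \<turnstile> (e \<turnstile> d)) + (e \<turnstile> (c \<stileturn> b) - (c \<stileturn> e) \<stileturn> b)"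
  by (simp add: assoc_x_def dbl_ld_def dbl_rd_def lin_add lin_diff st_ld st_rd algebra_simps)

text \<open>A symmetric element associates with everything and passes any factor if
  \<open>\<stileturn>\<close> and \<open>\<turnstile>\<close> are exchanged. This rule and the next
  two combine both facts: rebracket, swap the inner pair, rebracket again.\<close>

lemma rd_sym_left_commute: "x \<turnstile> (symm y \<turnstile> z) = symm y \<turnstile> (x \<turnstile> z)"
  by (metis ld_sym rd_bar rd_sym_assoc sym_rd_assoc)

lemma ld_sym_left_commute: "x \<turnstile> (symm y \<stileturn> z) = symm y \<stileturn> (x \<stileturn> z)"
  by (metis rd_sym_ld sym_ld sym_ld_assoc)

lemma sym_rd_ld_left_commute: "symm y \<turnstile> (x \<stileturn> z) = x \<stileturn> (symm y \<stileturn> z)"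
  by (metis ld_sym ld_sym_assoc sym_rd_ld)

lemmas sym_normalize = sym_ld_assoc ld_sym_assoc rd_sym_ld sym_rd_ld sym_rd_assoc rd_sym_assoc
  rd_sym_left_commute ld_sym_left_commute sym_rd_ld_left_commute

lemma symmetric_dialgebra_dbl:
  "symmetric_dialgebra (dbl_sc sc) DL DR (dbl_st st)"
proof -
  interpret dbl: involutive_dialgebra "dbl_sc sc" DL DR "dbl_st st"
    by unfold_locales (rule zero_dialg_dbl)
  \<comment> \<open>With \<open>dbl.symm p = (s, 0)\<close> and \<open>st s = s\<close>, the second
    components of the two products coincide outright; the first ones agree by \<open>sym_ld\<close>
    or \<open>ld_sym\<close>.\<close>
  have "dbl.br (dbl.symm p) q = 0" "dbl.br q (dbl.symm p) = 0" for p q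
    by (cases p; cases q;
        simp add: dibr_def sym_dbl dbl_ld_def dbl_rd_def sym_ld ld_sym zero_prod_def)+
  \<comment> \<open>In the first component every associator or bracket then has an argument that is
    \<open>0\<close> or symmetric; \<open>sym_normalize\<close> settles the second.\<close>
  moreover have
    "dbl.AL (dbl.symm p) q r = 0" "dbl.AL q (dbl.symm p) r = 0" "dbl.AL q r (dbl.symm p) = 0"
    "dbl.AX (dbl.symm p) q r = 0" "dbl.AX q (dbl.symm p) r = 0" "dbl.AX q r (dbl.symm p) = 0"
    for p q r
    by (cases p; cases q; cases r; rule prod_eqI;
        simp add: sym_dbl fst_assoc_l_dbl fst_assoc_x_dbl snd_assoc_l_dbl snd_assoc_x_dbl
          sym_normalize)+
  ultimately show ?thesis
    by unfold_locales (simp add: dbl.symmetric_dialg_iff)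
qed

lemma flexible_dialg_dbl:
  assumes "flexible_dialg sc ld rd st"
  shows "flexible_dialg (dbl_sc sc) DL DR (dbl_st st)"
proof -
  interpret dbl: symmetric_dialgebra "dbl_sc sc" DL DR "dbl_st st"
    by (rule symmetric_dialgebra_dbl)
  have [simp]: "symm (AL a b c) = 0" "symm (AX a b c) = 0" for a b c
    using assms by (simp_all add: flexible_dialg_iff)
  \<comment> \<open>\<open>AR a b c\<close> is the star of \<open>AL c b a\<close>, and
    \<open>symm\<close> takes the same value on an element and on its star.\<close>
  have [simp]: "symm (AR a b c) = 0" for a b c
    using sym_st[of "AL c b a"] by (simp add: st_assoc)
  have dbl_sym: "dbl.symm p = (symm (fst p), 0)" for p
    by (cases p) (simp add: sym_dbl)
  \<comment> \<open>Since \<open>symm\<close> is additive, it suffices that it kills each associator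
    and bracket in the first component.\<close>
  have "dbl.symm (dbl.AL p q r) = 0" "dbl.symm (dbl.AX p q r) = 0" for p q r
    by (cases p; cases q; cases r;
        simp add: dbl_sym fst_assoc_l_dbl fst_assoc_x_dbl sym_add sym_diff zero_prod_def)+
  then show ?thesis
    by (simp add: dbl.flexible_dialg_iff)
qed

end

theorem theorem7p5:
  fixes sc :: "'k::field \<Rightarrow> 'v::ab_group_add \<Rightarrow> 'v"
    and ld rd :: "'v \<Rightarrow> 'v \<Rightarrow> 'v" and st :: "'v \<Rightarrow> 'v"
  assumes "symmetric_dialg sc ld rd st"
    and "flexible_dialg sc ld rd st \<or> alternative_dialg sc ld rd st"
  shows "symmetric_dialg (dbl_sc sc) (dbl_ld ld rd st) (dbl_rd ld rd st) (dbl_st st) \<and>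
         flexible_dialg (dbl_sc sc) (dbl_ld ld rd st) (dbl_rd ld rd st) (dbl_st st)"
proof -
  interpret symmetric_dialgebra sc ld rd st
    using assms(1) by unfold_locales (auto simp: symmetric_dialg_def partially_symmetric_def)
  have "flexible_dialg sc ld rd st"
    using assms(2) alternative_imp_flexible by blast
  then show ?thesis
    using flexible_dialg_dbl symmetric_dialgebra.symmetric[OF symmetric_dialgebra_dbl] by blast
qed

end
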